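(* Let $g:\mathbb{R}^m\to\mathbb{R}$ be a convex Fréchet differentiable function with $L_g$-Lipschitz continuous gradient, and assume that $\operatorname{argmin} g\neq\emptyset$. Let $t_0>0$, $u_0,v_0\in\mathbb{R}^m$, $\alpha>3$ and $\beta\ge 0$. Let $x:[t_0,+\infty)\to\mathbb{R}^m$ be the unique strong global solution of the dynamical system $$\ddot{x}(t)+\frac{\alpha}{t}\dot{x}(t)+\nabla g\left(x(t)+\frac{\beta}{t}\dot{x}(t)\right)=0,\qquad x(t_0)=u_0,\ \dot{x}(t_0)=v_0.$$ Then there exist $K\ge 0$ and $t_1\ge t_0$ such that $$g\left(x(t)+\frac{\beta}{t}\dot{x}(t)\right)-\min g\le \frac{K}{t^2}\quad\text{for all }t\ge t_1,$$ and $$\int_{t_0}^{+\infty}t\left(g\left(x(t)+\frac{\beta}{t}\dot{x}(t)\right)-\min g\right)dt<+\infty.$$ Moreover, if $\beta>0$, then $$\int_{t_0}^{+\infty}t\left\|\nabla g\left(x(t)+\frac{\beta}{t}\dot{x}(t)\right)\right\|^2dt<+\infty.$$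
   Context: $\mathbb{R}^m$ carries the Euclidean norm $\|\cdot\|$. That $\nabla g$ is $L_g$-Lipschitz means $L_g\ge 0$ and $\|\nabla g(x)-\nabla g(y)\|\le L_g\|x-y\|$ for all $x,y\in\mathbb{R}^m$. A function $x:[t_0,+\infty)\to\mathbb{R}^m$ is a strong global solution of the dynamical system if: (i) $x$ and $\dot x$ are locally absolutely continuous on $[t_0,+\infty)$ (i.e. absolutely continuous on every compact interval $[t_0,T]$, $T>t_0$); (ii) the differential equation holds for almost every $t\ge t_0$; (iii) $x(t_0)=u_0$ and $\dot x(t_0)=v_0$. Under the stated assumptions such a solution exists and is unique. *)

theory Defs
  imports "HOL-Analysis.Analysis"
begin

definition grad :: "(real ^ 'm \<Rightarrow> real) \<Rightarrow> real ^ 'm \<Rightarrow> real ^ 'm" where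
  "grad g x = (THE D. GDERIV g x :> D)"

lemma GDERIV_grad:
  fixes g :: "real ^ 'm \<Rightarrow> real"
  assumes "g differentiable at x"
  shows "GDERIV g x :> grad g x"
proof -
  obtain g' where g': "(g has_derivative g') (at x)"
    using assms unfolding differentiable_def by blast
  have "g' h = inner h (adjoint g' 1)" for h
    using adjoint_works[OF has_derivative_linear[OF g'], of h 1] by simp
  then have rep: "g' = (\<lambda>h. inner h (adjoint g' 1))"
    by (rule ext)
  have ex: "GDERIV g x :> adjoint g' 1"
    unfolding gderiv_def by (rule subst[OF rep, of "\<lambda>f. (g has_derivative f) (at x)", OF g'])
  have uniq: "D = E" if "GDERIV g x :> D" "GDERIV g x :> E" for D E
  proof -
    have "(\<lambda>h. inner h D) = (\<lambda>h. inner h E)"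
      using that unfolding gderiv_def by (rule has_derivative_unique)
    then have "inner h D = inner h E" for h
      by (rule fun_cong)
    then show ?thesis
      using vector_eq_ldot by blast
  qed
  show ?thesis
    unfolding grad_def
    by (rule theI[of "\<lambda>D. GDERIV g x :> D" "adjoint g' 1"]) (use ex uniq in blast)+
qed

(* Absolute continuity of a function on a compact interval; the library constant
   absolutely_continuous is about measures. The finite families of nonoverlapping
   subintervals are given by their pairs of endpoints. *)
definition abs_cont_on_interval :: "real \<Rightarrow> real \<Rightarrow> (real \<Rightarrow> 'a::real_normed_vector) \<Rightarrow> bool" where
  "abs_cont_on_interval a b f \<longleftrightarrow>
     (\<forall>\<epsilon>>0. \<exists>\<delta>>0. \<forall>S :: (real \<times> real) set.
        finite S \<and> (\<forall>(l, u)\<in>S. a \<le> l \<and> l \<le> u \<and> u \<le> b) \<and>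
        disjoint_family_on (\<lambda>(l, u). {l<..<u}) S \<and> (\<Sum>(l, u)\<in>S. u - l) < \<delta>
        \<longrightarrow> (\<Sum>(l, u)\<in>S. norm (f u - f l)) < \<epsilon>)"

definition locally_abs_cont_from :: "real \<Rightarrow> (real \<Rightarrow> 'a::real_normed_vector) \<Rightarrow> bool" where
  "locally_abs_cont_from t0 f \<longleftrightarrow> (\<forall>T>t0. abs_cont_on_interval t0 T f)"

(* A function on [t0, \<infinity>) is a total function whose values below t0 are irrelevant;
   its derivative is taken within [t0, \<infinity>), hence is one-sided at t0. *)
definition deriv_from :: "real \<Rightarrow> (real \<Rightarrow> 'a::real_normed_vector) \<Rightarrow> real \<Rightarrow> 'a" where
  "deriv_from t0 f t = vector_derivative f (at t within {t0..})"

(* vector_derivative is an arbitrary value where no derivative exists, so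
   differentiability is required explicitly for both derivatives. *)
definition strong_global_solution ::
  "(real ^ 'm \<Rightarrow> real) \<Rightarrow> real \<Rightarrow> real \<Rightarrow> real \<Rightarrow> real ^ 'm \<Rightarrow> real ^ 'm \<Rightarrow>
   (real \<Rightarrow> real ^ 'm) \<Rightarrow> bool" where
  "strong_global_solution g \<alpha> \<beta> t0 u0 v0 x \<longleftrightarrow>
     x differentiable_on {t0..} \<and>
     locally_abs_cont_from t0 x \<and>
     locally_abs_cont_from t0 (deriv_from t0 x) \<and>
     (AE t in lebesgue. t \<ge> t0 \<longrightarrow>
        deriv_from t0 x differentiable (at t within {t0..}) \<and>
        deriv_from t0 (deriv_from t0 x) t + (\<alpha> / t) *\<^sub>R deriv_from t0 x t
          + grad g (x t + (\<beta> / t) *\<^sub>R deriv_from t0 x t) = 0) \<and>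
     x t0 = u0 \<and> deriv_from t0 x t0 = v0"

end

(*
  Since x' is absolutely continuous and x'' agrees almost everywhere with a continuous function,
  x is of class C^2. With y = x + (beta/t) x', z a minimiser of g, mu = (alpha + 1)/2 (so that
  2 < mu < alpha - 1) and a suitable weight a(t) >= t^2 with a'(t) <= 2t, the energy
    E(t) = a(t) (g(y) - g(z)) + |mu (x - z) + t x'|^2 / 2 + (alpha - 1 - mu) mu |x - z|^2 / 2
  satisfies E' <= -(mu - 2) t (g(y) - g(z)) - beta t |grad g(y)|^2 as soon as t^2 > (alpha + 1) beta.
  Monotonicity of E gives the rate, and integrating the inequality gives both integrability claims.
*)

theory Submission
  imports Defs
begin

section \<open>Absolute continuity and the fundamental theorem of calculus\<close>

lemma abs_cont_on_intervalE:
  assumes "abs_cont_on_interval a b f" "\<epsilon> > 0"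
  obtains \<delta> where "\<delta> > 0" and
    "\<forall>S. finite S \<and> (\<forall>(l, u)\<in>S. a \<le> l \<and> l \<le> u \<and> u \<le> b) \<and>
        disjoint_family_on (\<lambda>(l, u). {l<..<u}) S \<and> (\<Sum>(l, u)\<in>S. u - l) < \<delta>
        \<longrightarrow> (\<Sum>(l, u)\<in>S. norm (f u - f l)) < \<epsilon>"
  using assms(1)[unfolded abs_cont_on_interval_def, rule_format, OF assms(2)]
  by (elim exE conjE) (rule that)

text \<open>A family consisting of a single interval is enough.\<close>

lemma abs_cont_on_interval_imp_continuous_on:
  assumes "abs_cont_on_interval a b f"
  shows "continuous_on {a..b} f"
  unfolding continuous_on_iff
proof (intro ballI allI impI)
  fix x e :: real assume x: "x \<in> {a..b}" and e: "e > 0"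
  obtain d where d: "d > 0" and
    H: "\<forall>S. finite S \<and> (\<forall>(l, u)\<in>S. a \<le> l \<and> l \<le> u \<and> u \<le> b) \<and>
        disjoint_family_on (\<lambda>(l, u). {l<..<u}) S \<and> (\<Sum>(l, u)\<in>S. u - l) < d
        \<longrightarrow> (\<Sum>(l, u)\<in>S. norm (f u - f l)) < e"
    by (rule abs_cont_on_intervalE[OF assms e]) (rule that)
  have "dist (f y) (f x) < e" if y: "y \<in> {a..b}" and yx: "dist y x < d" for y
    using H[THEN spec, of "{(min x y, max x y)}"] x y yx
    by (auto simp: disjoint_family_on_def dist_norm min_def max_def norm_minus_commute split: if_splits)
  then show "\<exists>d>0. \<forall>y\<in>{a..b}. dist y x < d \<longrightarrow> dist (f y) (f x) < e"
    using d by blast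
qed

text \<open>Splitting the interval at \<open>t\<close> gives the errors \<open>e * (t - u)\<close>
  and \<open>e * (w - t)\<close>, which add up. A tagged division supplies a tag \<open>t\<close>
  between the endpoints.\<close>

lemma has_vector_derivative_interval_approx:
  fixes f :: "real \<Rightarrow> 'a::real_normed_vector"
  assumes "(f has_vector_derivative D) (at t within A)" "e > 0"
  obtains r where "r > 0"
    and "\<And>u w. u \<in> A \<Longrightarrow> w \<in> A \<Longrightarrow> u \<le> t \<Longrightarrow> t \<le> w \<Longrightarrow> {u..w} \<subseteq> ball t r \<Longrightarrow>
           norm ((w - u) *\<^sub>R D - (f w - f u)) \<le> e * (w - u)"
proof -
  obtain r where r: "r > 0" and
    H: "\<And>y. y \<in> A \<Longrightarrow> norm (y - t) < r \<Longrightarrow> norm (f y - f t - (y - t) *\<^sub>R D) \<le> e * norm (y - t)"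
    using assms unfolding has_vector_derivative_def has_derivative_within_alt by blast
  have "norm ((w - u) *\<^sub>R D - (f w - f u)) \<le> e * (w - u)"
    if "u \<in> A" "w \<in> A" "u \<le> t" "t \<le> w" and sub: "{u..w} \<subseteq> ball t r" for u w
  proof -
    have "u \<in> ball t r" "w \<in> ball t r"
      using subsetD[OF sub, of u] subsetD[OF sub, of w] that(3,4) by simp_all
    then have "norm (u - t) < r" "norm (w - t) < r"
      by (auto simp: dist_real_def)
    then have *: "norm (f u - f t - (u - t) *\<^sub>R D) \<le> e * (t - u)"
        "norm (f w - f t - (w - t) *\<^sub>R D) \<le> e * (w - t)"
      using H[of u] H[of w] that by auto
    have "(w - u) *\<^sub>R D - (f w - f u) = (f u - f t - (u - t) *\<^sub>R D) - (f w - f t - (w - t) *\<^sub>R D)"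
      by (simp add: algebra_simps)
    also have "norm \<dots> \<le> e * (t - u) + e * (w - t)"
      using norm_triangle_ineq4 * by (meson add_mono order_trans)
    finally show ?thesis by (simp add: algebra_simps)
  qed
  then show thesis using that r by blast
qed

text \<open>Disjointness turns the total length into the measure of the union, which lies in
  \<open>U\<close>. So a cover of small measure controls the lengths to which absolute continuity is
  applied.\<close>

lemma sum_content_open_le:
  fixes S :: "(real \<times> real) set"
  assumes "finite S" "disjoint_family_on (\<lambda>(l, u). {l<..<u}) S"
    and "\<And>l u. (l, u) \<in> S \<Longrightarrow> l \<le> u \<and> {l<..<u} \<subseteq> U" "U \<in> lmeasurable"
  shows "(\<Sum>(l, u)\<in>S. u - l) \<le> measure lebesgue U"
proof -
  have "(\<Sum>(l, u)\<in>S. u - l) = (\<Sum>s\<in>S. measure lebesgue ((\<lambda>(l, u). {l<..<u}) s))"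
    using assms(3) by (intro sum.cong) auto
  also have "\<dots> = measure lebesgue (\<Union>s\<in>S. (\<lambda>(l, u). {l<..<u}) s)"
    using assms(1,2) by (intro measure_finite_Union[symmetric]) (auto simp: assms(3) split: prod.splits)
  also have "\<dots> \<le> measure lebesgue U"
    using assms by (intro measure_mono_fmeasurable) (auto split: prod.splits)
  finally show ?thesis .
qed

text \<open>Outer regularity makes \<open>U - N\<close> small, and adding \<open>N\<close> back does
  not change the measure.\<close>

lemma negligible_open_superset:
  assumes N: "negligible N" and d: "(d::real) > 0"
  obtains U where "open U" "N \<subseteq> U" "U \<in> lmeasurable" "measure lebesgue U < d"
proof -
  obtain U where U: "open U" "N \<subseteq> U" "U - N \<in> lmeasurable" "emeasure lebesgue (U - N) < ennreal d"
    using sets_lebesgue_outer_open[OF negligible_imp_sets[OF N] d] by blast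
  have "U = N \<union> (U - N)"
    using U(2) by blast
  then have Um: "U \<in> lmeasurable"
    using U(3) negligible_imp_measurable[OF N] by (metis fmeasurable.Un)
  have "measure lebesgue U \<le> measure lebesgue N + measure lebesgue (U - N)"
    using \<open>U = N \<union> (U - N)\<close> measure_Un_le negligible_imp_sets[OF N] fmeasurableD[OF U(3)] by metis
  also have "\<dots> = measure lebesgue (U - N)"
    using negligible_imp_measure0[OF N] by simp
  also have "\<dots> < d"
    using U(3,4) d by (simp add: emeasure_eq_measure2 ennreal_less_iff)
  finally show thesis
    using that U Um by blast
qed

text \<open>
  The gauge keeps intervals tagged in \<open>N\<close> inside an open set so small that absolute continuity
  bounds their total increment; the other tags are treated as in the classical theorem.
\<close>

theorem fundamental_theorem_of_calculus_abs_cont: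
  fixes f :: "real \<Rightarrow> 'a::banach"
  assumes ac: "abs_cont_on_interval a b f" and "a \<le> b" and N: "negligible N"
    and der: "\<And>t. t \<in> {a..b} - N \<Longrightarrow> (f has_vector_derivative F t) (at t within {a..b})"
  shows "(F has_integral (f b - f a)) {a..b}"
proof (cases "a = b")
  case True
  then show ?thesis by (simp add: has_integral_refl)
next
  case False
  with \<open>a \<le> b\<close> have "a < b" by simp
  \<comment> \<open>With value 0 on \<open>N\<close>, a tag in \<open>N\<close> contributes only the
    increment of \<open>f\<close>. The change on a null set is undone at the end.\<close>
  define F0 where "F0 t = (if t \<in> N then 0 else F t)" for t
  have "(F0 has_integral (f b - f a)) {a..b}"
    unfolding has_integral_factor_content_real
  proof (intro allI impI)
    fix e :: real assume "e > 0"
    \<comment> \<open>The error splits in half: \<open>e1 * (b - a)\<close> for tags outside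
      \<open>N\<close> and \<open>e2\<close>, of the same size, for tags in
      \<open>N\<close>.\<close>
    define e1 where "e1 = e / 2"
    define e2 where "e2 = e1 * (b - a)"
    have e12: "e1 > 0" "e2 > 0" using \<open>e > 0\<close> \<open>a < b\<close> by (simp_all add: e1_def e2_def)
    obtain d where d: "d > 0" and
      H: "\<forall>S. finite S \<and> (\<forall>(l, u)\<in>S. a \<le> l \<and> l \<le> u \<and> u \<le> b) \<and>
        disjoint_family_on (\<lambda>(l, u). {l<..<u}) S \<and> (\<Sum>(l, u)\<in>S. u - l) < d
        \<longrightarrow> (\<Sum>(l, u)\<in>S. norm (f u - f l)) < e2"
      by (rule abs_cont_on_intervalE[OF ac e12(2)]) (rule that)
    obtain U where U: "open U" "N \<subseteq> U" "U \<in> lmeasurable" "measure lebesgue U < d"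
      by (rule negligible_open_superset[OF N d])
    \<comment> \<open>A radius for each tag: at a point of \<open>N\<close> the interval must stay
      in \<open>U\<close>, elsewhere in \<open>{a..b}\<close> the derivative approximates. For
      \<open>t\<close> outside \<open>{a..b}\<close> no interval qualifies and any radius will
      do.\<close>
    have "\<exists>r>0. \<forall>u w. a \<le> u \<longrightarrow> u \<le> t \<longrightarrow> t \<le> w \<longrightarrow> w \<le> b \<longrightarrow> {u..w} \<subseteq> ball t r \<longrightarrow>
        (if t \<in> N then {u..w} \<subseteq> U
         else norm ((w - u) *\<^sub>R F t - (f w - f u)) \<le> e1 * (w - u))" for t
    proof (cases "t \<in> N")
      case True
      then obtain r where "r > 0" "ball t r \<subseteq> U"
        using U by (meson open_contains_ball subsetD)
      then show ?thesis using True by auto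
    next
      case tN: False
      show ?thesis
      proof (cases "t \<in> {a..b}")
        case True
        then obtain r where "r > 0"
          "\<And>u w. u \<in> {a..b} \<Longrightarrow> w \<in> {a..b} \<Longrightarrow> u \<le> t \<Longrightarrow> t \<le> w \<Longrightarrow> {u..w} \<subseteq> ball t r \<Longrightarrow>
           norm ((w - u) *\<^sub>R F t - (f w - f u)) \<le> e1 * (w - u)"
          using has_vector_derivative_interval_approx[OF der[of t] e12(1)] tN by blast
        then show ?thesis using tN by (intro exI[of _ r]) auto
      next
        case False
        then show ?thesis by (intro exI[of _ 1]) auto
      qed
    qed
    then obtain r where r: "\<And>t. r t > 0" and
      rH: "\<And>t u w. a \<le> u \<Longrightarrow> u \<le> t \<Longrightarrow> t \<le> w \<Longrightarrow> w \<le> b \<Longrightarrow> {u..w} \<subseteq> ball t (r t) \<Longrightarrow>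
        (if t \<in> N then {u..w} \<subseteq> U
         else norm ((w - u) *\<^sub>R F t - (f w - f u)) \<le> e1 * (w - u))"
      by metis
    show "\<exists>\<gamma>. gauge \<gamma> \<and> (\<forall>p. p tagged_division_of {a..b} \<and> \<gamma> fine p \<longrightarrow>
      norm ((\<Sum>(x, K)\<in>p. measure lborel K *\<^sub>R F0 x) - (f b - f a)) \<le> e * measure lborel {a..b})"
    proof (intro exI[of _ "\<lambda>t. ball t (r t)"] conjI allI impI, goal_cases)
      case 1
      show ?case using r by (simp add: gauge_ball_dependent)
    next
      case (2 p)
      then have p: "p tagged_division_of {a..b}" and fine: "(\<lambda>t. ball t (r t)) fine p" by auto
      have fin: "finite p" by (rule tagged_division_ofD(1)[OF p])
      \<comment> \<open>Writing the intervals through \<open>Inf\<close> and \<open>Sup\<close>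
        makes the endpoints functions of the set.\<close>
      have K0: "K = {Inf K..Sup K}" and K: "a \<le> Inf K \<and> Inf K \<le> t \<and> t \<le> Sup K \<and> Sup K \<le> b
          \<and> {Inf K..Sup K} \<subseteq> ball t (r t)" if tK: "(t, K) \<in> p" for t K
      proof -
        have t: "t \<in> K" "K \<subseteq> {a..b}" "K \<subseteq> ball t (r t)"
          using tagged_division_ofD(2,3)[OF p tK] fineD[OF fine tK] by blast+
        obtain u w where uw: "K = {u..w}"
          using tagged_division_ofD(4)[OF p tK] by auto
        then have "u \<le> w" using t(1) by simp
        then have "Inf K = u" "Sup K = w" using uw by simp_all
        then show "K = {Inf K..Sup K}" "a \<le> Inf K \<and> Inf K \<le> t \<and> t \<le> Sup K \<and> Sup K \<le> b
          \<and> {Inf K..Sup K} \<subseteq> ball t (r t)"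
          using t uw \<open>u \<le> w\<close> by auto
      qed
      \<comment> \<open>Only nondegenerate intervals are kept: injectivity of \<open>\<phi>\<close>
        is derived from nonempty interiors, and the dropped intervals have zero increment.\<close>
      define q where "q = {(t, K). (t, K) \<in> p \<and> t \<in> N \<and> Inf K < Sup K}"
      define \<phi> where "\<phi> = (\<lambda>(t::real, K::real set). (Inf K, Sup K))"
      have disj: "{Inf K<..<Sup K} \<inter> {Inf K'<..<Sup K'} = {}"
        if "(t, K) \<in> p" "(t', K') \<in> p" "(t, K) \<noteq> (t', K')" for t K t' K'
      proof -
        have "interior K \<inter> interior K' = {}" using tagged_division_ofD(5)[OF p that] .
        moreover have "interior K = {Inf K<..<Sup K}" "interior K' = {Inf K'<..<Sup K'}"
          using K0[OF that(1)] K0[OF that(2)] interior_atLeastAtMost_real by metis+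
        ultimately show ?thesis by simp
      qed
      have qp: "q \<subseteq> p" "finite q" using fin by (auto simp: q_def intro: finite_subset[of _ p])
      have inj: "inj_on \<phi> q"
        unfolding inj_on_def
      proof (clarify, rule ccontr)
        fix t K t' K'
        assume A: "(t, K) \<in> q" "(t', K') \<in> q" "\<phi> (t, K) = \<phi> (t', K')" "\<not> (t = t' \<and> K = K')"
        then have "{Inf K<..<Sup K} \<inter> {Inf K<..<Sup K} = {}"
          using disj[of t K t' K'] qp by (auto simp: \<phi>_def)
        then show False using A(1) by (auto simp: q_def)
      qed
      have "(\<Sum>(l, u)\<in>\<phi> ` q. norm (f u - f l)) < e2"
      proof (rule H[THEN spec, THEN mp], intro conjI)
        show "finite (\<phi> ` q)" using qp by simp
        show "\<forall>(l, u)\<in>\<phi> ` q. a \<le> l \<and> l \<le> u \<and> u \<le> b"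
          using K qp by (fastforce simp: \<phi>_def)
        show dj: "disjoint_family_on (\<lambda>(l, u). {l<..<u}) (\<phi> ` q)"
          unfolding disjoint_family_on_def
        proof (intro ballI impI)
          fix m n assume "m \<in> \<phi> ` q" "n \<in> \<phi> ` q" "m \<noteq> n"
          then obtain t K t' K' where tK: "(t, K) \<in> q" "(t', K') \<in> q"
            and m: "m = (Inf K, Sup K)" and n: "n = (Inf K', Sup K')"
            by (auto simp: \<phi>_def)
          then have A: "(t, K) \<in> p" "(t', K') \<in> p" "(t, K) \<noteq> (t', K')"
            using qp \<open>m \<noteq> n\<close> by auto
          show "(case m of (l, u) \<Rightarrow> {l<..<u}) \<inter> (case n of (l, u) \<Rightarrow> {l<..<u}) = {}"
            using disj[OF A] by (simp add: m n)
        qed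
        have "(\<Sum>(l, u)\<in>\<phi> ` q. u - l) \<le> measure lebesgue U"
        proof (rule sum_content_open_le[OF _ dj _ U(3)])
          fix l u assume "(l, u) \<in> \<phi> ` q"
          then obtain t K where tK: "(t, K) \<in> p" "t \<in> N" "l = Inf K" "u = Sup K"
            by (auto simp: \<phi>_def q_def)
          have "{l..u} \<subseteq> U" using rH[of "Inf K" t "Sup K"] K[OF tK(1)] tK by auto
          then show "l \<le> u \<and> {l<..<u} \<subseteq> U"
            using K[OF tK(1)] tK greaterThanLessThan_subseteq_atLeastAtMost_iff by auto
        qed (use qp in auto)
        then show "(\<Sum>(l, u)\<in>\<phi> ` q. u - l) < d" using U by simp
      qed
      moreover have "(\<Sum>(l, u)\<in>\<phi> ` q. norm (f u - f l)) = (\<Sum>(t, K)\<in>q. norm (f (Sup K) - f (Inf K)))"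
        by (subst sum.reindex[OF inj]) (auto simp: \<phi>_def intro!: sum.cong)
      moreover have "\<dots> = (\<Sum>(t, K)\<in>p. if t \<in> N then norm (f (Sup K) - f (Inf K)) else 0)"
      proof (rule sum.mono_neutral_cong_left[OF fin qp(1)])
        have "Inf K = Sup K" if "(t, K) \<in> p" "t \<in> N" "(t, K) \<notin> q" for t K
          using that K[OF that(1)] by (auto simp: q_def)
        then show "\<forall>i\<in>p - q. (case i of (t, K) \<Rightarrow> if t \<in> N then norm (f (Sup K) - f (Inf K)) else 0) = 0"
          by auto
      qed (auto simp: q_def)
      ultimately have exceptional: "(\<Sum>(t, K)\<in>p. if t \<in> N then norm (f (Sup K) - f (Inf K)) else 0) < e2"
        by simp
      \<comment> \<open>Lengths and increments telescope over the division, so the error can be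
        estimated interval by interval.\<close>
      have ba: "b - a = (\<Sum>(t,K)\<in>p. Sup K - Inf K)" "f b - f a = (\<Sum>(t,K)\<in>p. f (Sup K) - f (Inf K))"
        using additive_tagged_division_1[where f= "\<lambda>x. x"] additive_tagged_division_1[where f= f]
            \<open>a \<le> b\<close> p by auto
      have "norm ((\<Sum>(x, K)\<in>p. measure lborel K *\<^sub>R F0 x) - (f b - f a))
          = norm (\<Sum>(t, K)\<in>p. measure lborel K *\<^sub>R F0 t - (f (Sup K) - f (Inf K)))"
        unfolding ba by (simp add: sum_subtractf split_def)
      also have "\<dots> \<le> (\<Sum>(t, K)\<in>p. e1 * (Sup K - Inf K) + (if t \<in> N then norm (f (Sup K) - f (Inf K)) else 0))"
      proof (rule sum_norm_le, clarify)
        fix t K assume tK: "(t, K) \<in> p"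
        have c: "measure lborel K = Sup K - Inf K"
          using content_real[of "Inf K" "Sup K"] K[OF tK] K0[OF tK] by (metis order_trans)
        show "norm (measure lborel K *\<^sub>R F0 t - (f (Sup K) - f (Inf K)))
          \<le> e1 * (Sup K - Inf K) + (if t \<in> N then norm (f (Sup K) - f (Inf K)) else 0)"
          using rH[of "Inf K" t "Sup K"] K[OF tK] e12 unfolding c
          by (auto simp: F0_def norm_minus_commute)
      qed
      also have "\<dots> = e1 * (b - a) + (\<Sum>(t, K)\<in>p. if t \<in> N then norm (f (Sup K) - f (Inf K)) else 0)"
        unfolding ba by (simp add: sum.distrib split_def sum_distrib_left)
      also have "\<dots> \<le> e1 * (b - a) + e2" using exceptional by simp
      also have "\<dots> = e * measure lborel {a..b}" using \<open>a \<le> b\<close> by (simp add: e2_def e1_def field_simps)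
      finally show ?case by simp
    qed
  qed
  then show ?thesis
    by (rule has_integral_spike[OF N, rotated]) (simp add: F0_def)
qed

section \<open>The tangent inequality for convex functions\<close>

text \<open>Along the line through \<open>y\<close> and \<open>z\<close>, \<open>g\<close> becomes a
  convex function of one variable, which lies above its tangent at 0; this is evaluated at
  1.\<close>

lemma convex_on_gradient_ineq:
  fixes g :: "real ^ 'm \<Rightarrow> real"
  assumes cvx: "convex_on UNIV g" and "g differentiable at y"
  shows "g y + (z - y) \<bullet> grad g y \<le> g z"
proof -
  define \<psi> where "\<psi> s = g (y + s *\<^sub>R (z - y))" for s :: real
  have "convex_on UNIV \<psi>"
  proof (rule convex_onI)
    fix s a b :: real assume s: "0 < s" "s < 1"
    have *: "y + ((1 - s) *\<^sub>R a + s *\<^sub>R b) *\<^sub>R (z - y)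
        = (1 - s) *\<^sub>R (y + a *\<^sub>R (z - y)) + s *\<^sub>R (y + b *\<^sub>R (z - y))"
      by (simp add: scaleR_left_distrib scaleR_right_distrib scaleR_left_diff_distrib scaleR_right_diff_distrib)
    show "\<psi> ((1 - s) *\<^sub>R a + s *\<^sub>R b) \<le> (1 - s) * \<psi> a + s * \<psi> b"
      unfolding \<psi>_def * by (rule convex_onD[OF cvx]) (use s in auto)
  qed simp
  moreover have "(\<psi> has_field_derivative (z - y) \<bullet> grad g y) (at 0)"
  proof -
    have "((\<lambda>s. y + s *\<^sub>R (z - y)) has_derivative (\<lambda>s. s *\<^sub>R (z - y))) (at (0::real))"
      by (auto intro!: derivative_eq_intros)
    moreover have "(g has_derivative (\<lambda>h. h \<bullet> grad g y)) (at (y + 0 *\<^sub>R (z - y)))"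
      using GDERIV_grad[OF assms(2)] by (simp add: gderiv_def)
    ultimately have "(\<psi> has_derivative (\<lambda>s. (s *\<^sub>R (z - y)) \<bullet> grad g y)) (at 0)"
      unfolding \<psi>_def by (rule has_derivative_compose)
    then show ?thesis
      by (simp add: has_field_derivative_def mult_commute_abs)
  qed
  ultimately have "\<psi> 1 - \<psi> 0 \<ge> (z - y) \<bullet> grad g y * (1 - 0)"
    by (intro convex_on_imp_above_tangent[where A = UNIV]) auto
  then show ?thesis by (simp add: \<psi>_def)
qed

section \<open>Integrability on a half-line from a Lyapunov function\<close>

text \<open>The integrals over \<open>{a..T}\<close> increase with \<open>T\<close> and are bounded,
  so they converge; since \<open>f\<close> is nonnegative on \<open>{a..}\<close>, this gives
  absolute integrability.\<close>

lemma set_integrable_atLeast_of_bounded_integrals: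
  fixes f :: "real \<Rightarrow> real"
  assumes cont: "continuous_on {a..} f" and nonneg: "\<And>t. t \<ge> a \<Longrightarrow> f t \<ge> 0"
    and bound: "\<And>T. T \<ge> a \<Longrightarrow> integral {a..T} f \<le> M"
  shows "set_integrable lborel {a..} f"
proof -
  have int: "f integrable_on {a..T}" for T
    by (intro integrable_continuous_real continuous_on_subset[OF cont]) auto
  define I where "I T = integral {a..T} f" for T
  have mono: "mono I"
    unfolding I_def by (intro monoI integral_subset_le int) (use nonneg in auto)
  \<comment> \<open>For \<open>T < a\<close> the interval is empty and the integral 0, hence the
    maximum with 0.\<close>
  have bdd: "I T \<le> max M 0" for T
    using bound[of T] by (cases "T \<ge> a") (auto simp: I_def)
  have "incseq (\<lambda>n. I (real n))"
    using mono by (auto simp: mono_def)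
  then obtain l where "(\<lambda>n. I (real n)) \<longlonglongrightarrow> l"
    using bdd incseq_convergent by blast
  then have "(I \<longlongrightarrow> l) at_top"
    using mono by (intro tendsto_at_topI_sequentially_real) (auto simp: mono_def)
  then have "(f has_integral l) {a..}"
    using int nonneg by (intro has_integral_to_inf) (auto simp: I_def[abs_def])
  then have "f absolutely_integrable_on {a..}"
    using nonneg by (intro nonnegative_absolutely_integrable_1) auto
  \<comment> \<open>Absolute integrability refers to the completed measure; Borel measurability
    transfers it to \<open>lborel\<close>.\<close>
  moreover have "(\<lambda>t. indicator {a..} t *\<^sub>R f t) \<in> borel_measurable lborel"
    using borel_measurable_continuous_on_indicator[OF _ cont] by simp
  ultimately show ?thesis
    unfolding set_integrable_def by (simp add: integrable_completion)
qed

text \<open>By the fundamental theorem for the gauge integral, the derivative \<open>D\<close> is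
  integrable as it stands; the integral of \<open>- D\<close> is then compared with that of
  \<open>f\<close>.\<close>

lemma lyapunov_decrease:
  fixes E D f :: "real \<Rightarrow> real"
  assumes deriv: "\<And>t. t \<ge> a \<Longrightarrow> (E has_real_derivative D t) (at t)"
    and decay: "\<And>t. t \<ge> a \<Longrightarrow> f t \<le> - D t"
    and cont: "continuous_on {a..} f" and "a \<le> T"
  shows "integral {a..T} f \<le> E a - E T"
proof -
  have "(D has_integral E T - E a) {a..T}"
  proof (rule fundamental_theorem_of_calculus[OF \<open>a \<le> T\<close>])
    fix t assume "t \<in> {a..T}"
    then have "(E has_real_derivative D t) (at t)" by (intro deriv) simp
    then show "(E has_vector_derivative D t) (at t within {a..T})"
      by (rule has_vector_derivative_at_within[OF has_real_derivative_iff_has_vector_derivative[THEN iffD1]])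
  qed
  from has_integral_neg[OF this] have D: "((\<lambda>t. - D t) has_integral E a - E T) {a..T}"
    by simp
  have "f integrable_on {a..T}"
    by (intro integrable_continuous_real continuous_on_subset[OF cont]) auto
  then show ?thesis
    by (rule has_integral_le[OF integrable_integral D]) (simp add: decay)
qed

text \<open>Nonnegativity of \<open>E\<close> turns its decrease into the bound
  \<open>E a / k\<close> for all integrals starting at \<open>a\<close>; on \<open>{t0..a}\<close>
  continuity suffices. The separate start \<open>a\<close> serves an energy that is controlled only
  for large times.\<close>

lemma set_integrable_of_lyapunov:
  fixes E D f :: "real \<Rightarrow> real"
  assumes cont: "continuous_on {t0..} f" and nonneg: "\<And>t. t \<ge> t0 \<Longrightarrow> f t \<ge> 0"
    and "t0 \<le> a" "k > 0"
    and deriv: "\<And>t. t \<ge> a \<Longrightarrow> (E has_real_derivative D t) (at t)"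
    and decay: "\<And>t. t \<ge> a \<Longrightarrow> k * f t \<le> - D t"
    and E: "\<And>t. t \<ge> a \<Longrightarrow> E t \<ge> 0"
  shows "set_integrable lborel {t0..} f"
proof -
  have cont': "continuous_on {a..} f"
    using \<open>t0 \<le> a\<close> by (intro continuous_on_subset[OF cont]) auto
  have "integral {a..T} f \<le> E a / k" if "T \<ge> a" for T
  proof -
    have "integral {a..T} (\<lambda>t. k * f t) \<le> E a - E T"
      by (rule lyapunov_decrease[OF deriv decay continuous_on_mult_left[OF cont'] that])
    then have "k * integral {a..T} f \<le> E a"
      using E[OF that] by simp
    then show ?thesis
      using \<open>k > 0\<close> by (simp add: pos_le_divide_eq mult.commute)
  qed
  then have "set_integrable lborel {a..} f"
    using cont' nonneg \<open>t0 \<le> a\<close> by (intro set_integrable_atLeast_of_bounded_integrals) auto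
  moreover have "set_integrable lborel {t0..a} f"
    by (intro borel_integrable_atLeastAtMost' continuous_on_subset[OF cont]) auto
  ultimately have "set_integrable lborel ({t0..a} \<union> {a..}) f"
    by (intro set_integrable_Un) auto
  moreover have "{t0..a} \<union> {a..} = {t0..}"
    using \<open>t0 \<le> a\<close> by auto
  ultimately show ?thesis by simp
qed

section \<open>Regularity of strong solutions\<close>

lemma at_within_atLeast_eq_Icc:
  fixes t :: real
  assumes "t < T"
  shows "at t within {a..} = at t within {a..T}"
  by (rule at_within_nhd[of t "{..<T}"]) (use assms in auto)

lemma continuous_on_atLeast:
  fixes f :: "real \<Rightarrow> 'a::topological_space"
  assumes "\<And>T. T > a \<Longrightarrow> continuous_on {a..T} f"
  shows "continuous_on {a..} f"
  unfolding continuous_on_def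
proof
  fix t assume "t \<in> {a..}"
  then have "continuous_on {a..t + 1} f" "t \<in> {a..t + 1}"
    using assms by auto
  then show "(f \<longlongrightarrow> f t) (at t within {a..})"
    unfolding continuous_on_def using at_within_atLeast_eq_Icc[of t "t + 1" a] by auto
qed

text \<open>Absolute continuity makes \<open>f\<close> a primitive of its almost everywhere
  derivative \<open>F\<close>, and a primitive of a continuous function is differentiable at every
  point. For \<open>t > a\<close> the derivative is two-sided.\<close>

lemma abs_cont_derivative_everywhere:
  fixes f :: "real \<Rightarrow> 'a::banach"
  assumes ac: "locally_abs_cont_from a f" and cont: "continuous_on {a..} F"
    and ae: "AE t in lebesgue. t \<ge> a \<longrightarrow> (f has_vector_derivative F t) (at t within {a..})"
    and "t > a"
  shows "(f has_vector_derivative F t) (at t)"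
proof -
  define T where "T = t + 1"
  have contT: "continuous_on {a..T} F"
    by (rule continuous_on_subset[OF cont]) auto
  obtain N where N: "negligible N"
    and der: "\<And>s. s \<notin> N \<Longrightarrow> s \<ge> a \<Longrightarrow> (f has_vector_derivative F s) (at s within {a..})"
    using AE_E3[OF ae] by (auto simp: negligible_iff_null_sets)
  have f_eq: "f s = f a + integral {a..s} F" if "s \<in> {a..T}" for s
  proof (cases "s = a")
    case False
    with that have "s > a" by simp
    have "(F has_integral (f s - f a)) {a..s}"
    proof (rule fundamental_theorem_of_calculus_abs_cont[OF _ _ N])
      show "abs_cont_on_interval a s f"
        using ac \<open>s > a\<close> by (simp add: locally_abs_cont_from_def)
      show "(f has_vector_derivative F r) (at r within {a..s})" if "r \<in> {a..s} - N" for r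
        using that by (intro has_vector_derivative_within_subset[OF der]) auto
    qed (use \<open>s > a\<close> in auto)
    then show ?thesis by (simp add: integral_unique)
  qed simp
  have tT: "t \<in> {a..T}" using \<open>t > a\<close> by (simp add: T_def)
  have D: "((\<lambda>s. f a + integral {a..s} F) has_vector_derivative F t) (at t within {a..T})"
    using has_vector_derivative_add[OF has_vector_derivative_const integral_has_vector_derivative[OF contT tT]]
    by simp
  have "(f has_vector_derivative F t) (at t within {a..T})"
    by (rule has_vector_derivative_transform[OF tT _ D]) (rule f_eq)
  then show ?thesis
    using \<open>t > a\<close> by (simp add: T_def at_within_Icc_at)
qed

text \<open>The equation, solved for the second derivative, has a right side continuous in time.
  Hence it holds at every \<open>t > t0\<close>, and the energy can be differentiated
  pointwise.\<close>

lemma strong_global_solution_regular: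
  fixes g :: "real ^ 'm \<Rightarrow> real"
  assumes sol: "strong_global_solution g \<alpha> \<beta> t0 u0 v0 x" and "t0 > 0"
    and grad: "continuous_on UNIV (grad g)"
  shows "continuous_on {t0..} x" and "continuous_on {t0..} (deriv_from t0 x)"
    and "\<And>t. t > t0 \<Longrightarrow> (x has_vector_derivative deriv_from t0 x t) (at t)"
    and "\<And>t. t > t0 \<Longrightarrow> (deriv_from t0 x has_vector_derivative
           - (\<alpha> / t) *\<^sub>R deriv_from t0 x t - grad g (x t + (\<beta> / t) *\<^sub>R deriv_from t0 x t)) (at t)"
proof -
  define v where "v = deriv_from t0 x"
  define F where "F t = - (\<alpha> / t) *\<^sub>R v t - grad g (x t + (\<beta> / t) *\<^sub>R v t)" for t
  have xdiff: "x differentiable_on {t0..}" and vac: "locally_abs_cont_from t0 v"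
    and ode: "AE t in lebesgue. t \<ge> t0 \<longrightarrow> v differentiable (at t within {t0..}) \<and>
        deriv_from t0 v t + (\<alpha> / t) *\<^sub>R v t + grad g (x t + (\<beta> / t) *\<^sub>R v t) = 0"
    using sol unfolding strong_global_solution_def v_def by blast+
  show xcont: "continuous_on {t0..} x"
    by (rule differentiable_imp_continuous_on[OF xdiff])
  have vcont: "continuous_on {t0..} v"
    using vac unfolding locally_abs_cont_from_def
    by (intro continuous_on_atLeast abs_cont_on_interval_imp_continuous_on) blast
  then show "continuous_on {t0..} (deriv_from t0 x)" by (simp add: v_def)
  show "(x has_vector_derivative deriv_from t0 x t) (at t)" if "t > t0" for t
  proof -
    have "(x has_vector_derivative deriv_from t0 x t) (at t within {t0..})"
      using xdiff that unfolding differentiable_on_def deriv_from_def vector_derivative_works[symmetric]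
      by simp
    then have "(x has_vector_derivative deriv_from t0 x t) (at t within {t0<..})"
      by (rule has_vector_derivative_within_subset) auto
    then show ?thesis
      using that by (simp add: at_within_open[of t "{t0<..}"])
  qed
  have "continuous_on {t0..} F"
    unfolding F_def using \<open>t0 > 0\<close>
    by (intro continuous_intros vcont xcont continuous_on_compose2[OF grad]) auto
  moreover have "AE t in lebesgue. t \<ge> t0 \<longrightarrow> (v has_vector_derivative F t) (at t within {t0..})"
    using ode
  proof eventually_elim
    case (elim t)
    show ?case
    proof
      assume "t \<ge> t0"
      with elim have vdiff: "v differentiable (at t within {t0..})"
        and eq: "deriv_from t0 v t + (\<alpha> / t) *\<^sub>R v t + grad g (x t + (\<beta> / t) *\<^sub>R v t) = 0"
        by blast+
      have "deriv_from t0 v t = (deriv_from t0 v t + (\<alpha> / t) *\<^sub>R v t + grad g (x t + (\<beta> / t) *\<^sub>R v t))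
          - (\<alpha> / t) *\<^sub>R v t - grad g (x t + (\<beta> / t) *\<^sub>R v t)"
        by simp
      also have "\<dots> = F t"
        unfolding eq F_def by simp
      finally show "(v has_vector_derivative F t) (at t within {t0..})"
        using vdiff unfolding deriv_from_def by (metis vector_derivative_works)
    qed
  qed
  ultimately have "(v has_vector_derivative F t) (at t)" if "t > t0" for t
    by (intro abs_cont_derivative_everywhere[OF vac]) (use that in auto)
  then show "(deriv_from t0 x has_vector_derivative
           - (\<alpha> / t) *\<^sub>R deriv_from t0 x t - grad g (x t + (\<beta> / t) *\<^sub>R deriv_from t0 x t)) (at t)"
    if "t > t0" for t
    using that by (simp add: v_def F_def)
qed

section \<open>The energy and its weight\<close>

text \<open>
  Chosen so that the \<open>v \<bullet> \<nabla>g(y)\<close> terms cancel in the derivative of the energy: it equals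
  \<open>t\<^sup>2 (t\<^sup>2 - \<mu>\<beta>) / (t\<^sup>2 - (\<alpha> + 1)\<beta>)\<close>, written as \<open>t\<^sup>2\<close> plus a nonincreasing function.
\<close>

definition energy_weight :: "real \<Rightarrow> real \<Rightarrow> real \<Rightarrow> real \<Rightarrow> real" where
  "energy_weight \<alpha> \<beta> \<mu> t =
     t\<^sup>2 + (\<alpha> + 1 - \<mu>) * \<beta> + (\<alpha> + 1 - \<mu>) * \<beta> * ((\<alpha> + 1) * \<beta>) / (t\<^sup>2 - (\<alpha> + 1) * \<beta>)"

text \<open>The second factor on the left is the coefficient of \<open>v\<close> in the derivative
  of \<open>x + (\<beta> / t) v\<close>. The right side is the negative of the coefficient of
  \<open>v \<bullet> \<nabla>g(y)\<close> that the squared norm in \<open>energy\<close>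
  produces.\<close>

lemma energy_weight_balance:
  assumes "t > 0" "t\<^sup>2 > (\<alpha> + 1) * \<beta>"
  shows "energy_weight \<alpha> \<beta> \<mu> t * (1 - (\<alpha> + 1) * \<beta> / t\<^sup>2) = t\<^sup>2 - \<mu> * \<beta>"
proof -
  define c k where "c = (\<alpha> + 1) * \<beta>" and "k = (\<alpha> + 1 - \<mu>) * \<beta>"
  have "t\<^sup>2 \<noteq> 0" "t\<^sup>2 - c \<noteq> 0" using assms by (auto simp: c_def)
  then have "(t\<^sup>2 + k + k * c / (t\<^sup>2 - c)) * (1 - c / t\<^sup>2) = t\<^sup>2 - c + k"
    by (simp add: divide_simps) (simp add: algebra_simps)
  then show ?thesis
    by (simp add: energy_weight_def c_def k_def algebra_simps)
qed

text \<open>Both terms added to \<open>t\<^sup>2\<close> are nonnegative.\<close>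

lemma energy_weight_ge:
  assumes "t\<^sup>2 > (\<alpha> + 1) * \<beta>" "\<beta> \<ge> 0" "\<alpha> + 1 \<ge> 0" "\<mu> \<le> \<alpha> + 1"
  shows "energy_weight \<alpha> \<beta> \<mu> t \<ge> t\<^sup>2"
  using assms by (simp add: energy_weight_def)

text \<open>The fraction is nonincreasing in \<open>t\<close>. Only the upper bound on the
  derivative is used later, hence the existential form.\<close>

lemma energy_weight_deriv:
  assumes "t > 0" "t\<^sup>2 > (\<alpha> + 1) * \<beta>" "\<beta> \<ge> 0" "\<alpha> + 1 \<ge> 0" "\<mu> \<le> \<alpha> + 1"
  shows "\<exists>a'\<le>2 * t. (energy_weight \<alpha> \<beta> \<mu> has_real_derivative a') (at t)"
proof -
  define c k where "c = (\<alpha> + 1) * \<beta>" and "k = (\<alpha> + 1 - \<mu>) * \<beta>"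
  have nz: "t\<^sup>2 - c \<noteq> 0" using assms by (auto simp: c_def)
  have "((\<lambda>t. t\<^sup>2 + k + k * c / (t\<^sup>2 - c)) has_real_derivative
      (2 * t - 2 * t * (k * c) / (t\<^sup>2 - c)\<^sup>2)) (at t)"
    using nz by (auto intro!: derivative_eq_intros simp: power2_eq_square)
  then have "(energy_weight \<alpha> \<beta> \<mu> has_real_derivative (2 * t - 2 * t * (k * c) / (t\<^sup>2 - c)\<^sup>2)) (at t)"
    unfolding energy_weight_def[abs_def] c_def k_def .
  moreover have "0 \<le> 2 * t * (k * c) / (t\<^sup>2 - c)\<^sup>2"
    using assms by (simp add: c_def k_def)
  ultimately show ?thesis by (intro exI[of _ "2 * t - 2 * t * (k * c) / (t\<^sup>2 - c)\<^sup>2"]) auto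
qed

text \<open>The factor of the last term is chosen so that its derivative cancels the product of
  \<open>x t - z\<close> and \<open>v t\<close> coming from the middle term.\<close>

definition energy ::
  "('a::real_inner \<Rightarrow> real) \<Rightarrow> real \<Rightarrow> real \<Rightarrow> real \<Rightarrow> 'a \<Rightarrow> (real \<Rightarrow> 'a) \<Rightarrow> (real \<Rightarrow> 'a) \<Rightarrow> real \<Rightarrow> real" where
  "energy g \<alpha> \<beta> \<mu> z x v t =
     energy_weight \<alpha> \<beta> \<mu> t * (g (x t + (\<beta> / t) *\<^sub>R v t) - g z)
     + (norm (\<mu> *\<^sub>R (x t - z) + t *\<^sub>R v t))\<^sup>2 / 2
     + (\<alpha> - 1 - \<mu>) * \<mu> / 2 * (norm (x t - z))\<^sup>2"

section \<open>Dissipation of the energy\<close>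

lemma has_real_derivative_half_norm_square:
  fixes f :: "real \<Rightarrow> 'a::real_inner"
  assumes "(f has_vector_derivative f') (at t)"
  shows "((\<lambda>t. (norm (f t))\<^sup>2 / 2) has_real_derivative f t \<bullet> f') (at t)"
proof -
  have "((\<lambda>t. f t \<bullet> f t) has_vector_derivative f t \<bullet> f' + f' \<bullet> f t) (at t)"
    by (rule bounded_bilinear.has_vector_derivative[OF bounded_bilinear_inner assms assms])
  then have "((\<lambda>t. f t \<bullet> f t) has_real_derivative f t \<bullet> f' + f' \<bullet> f t) (at t)"
    by (simp only: has_real_derivative_iff_has_vector_derivative)
  from DERIV_cdivide[OF this, of 2] show ?thesis
    by (simp add: power2_norm_eq_inner inner_commute)
qed

text \<open>Here \<open>h\<close> is the gradient of \<open>g\<close> at \<open>y t\<close>. Once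
  the mixed terms cancel, the weight contributes at most \<open>2 * t\<close> times the gap in
  \<open>g\<close>, the tangent inequality gives \<open>- \<mu> * t\<close> times the gap, and the
  remaining terms have a sign.\<close>

lemma energy_deriv:
  fixes x v :: "real \<Rightarrow> 'a::real_inner" and \<beta> :: real
  defines "y \<equiv> \<lambda>t. x t + (\<beta> / t) *\<^sub>R v t"
  assumes x: "(x has_vector_derivative v t) (at t)"
    and v: "(v has_vector_derivative - (\<alpha> / t) *\<^sub>R v t - h) (at t)"
    and g: "(g has_derivative (\<lambda>k. k \<bullet> h)) (at (y t))"
    and tangent: "g (y t) + (z - y t) \<bullet> h \<le> g z" and "g z \<le> g (y t)"
    and t: "t > 0" "t\<^sup>2 > (\<alpha> + 1) * \<beta>" and \<beta>: "\<beta> \<ge> 0" and \<mu>: "0 \<le> \<mu>" "\<mu> \<le> \<alpha> - 1"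
  shows "\<exists>D. (energy g \<alpha> \<beta> \<mu> z x v has_real_derivative D) (at t) \<and>
             (\<mu> - 2) * (t * (g (y t) - g z)) + \<beta> * (t * (norm h)\<^sup>2) \<le> - D"
proof -
  define c where "c = (\<alpha> + 1) * \<beta>"
  define A where "A = energy_weight \<alpha> \<beta> \<mu> t"
  define \<phi> where "\<phi> = g (y t) - g z"
  obtain a' where a': "a' \<le> 2 * t" and A_deriv: "(energy_weight \<alpha> \<beta> \<mu> has_real_derivative a') (at t)"
    using energy_weight_deriv[of t \<alpha> \<beta> \<mu>] t \<beta> \<mu> by auto
  have A_ge: "A \<ge> t\<^sup>2"
    unfolding A_def using t \<beta> \<mu> by (intro energy_weight_ge) auto
  have A_balance: "A * (1 - c / t\<^sup>2) = t\<^sup>2 - \<mu> * \<beta>"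
    unfolding A_def c_def by (rule energy_weight_balance[OF t])
  \<comment> \<open>The derivative of \<open>y\<close>: the damping and the derivative of
    \<open>\<beta> / t\<close> merge into \<open>c / t\<^sup>2\<close>.\<close>
  define y' where "y' = (1 - c / t\<^sup>2) *\<^sub>R v t - (\<beta> / t) *\<^sub>R h"
  have "((\<lambda>t. \<beta> / t) has_real_derivative - (\<beta> / t\<^sup>2)) (at t)"
    using t by (auto intro!: derivative_eq_intros simp: power2_eq_square)
  from has_vector_derivative_add[OF x has_vector_derivative_scaleR[OF this v]]
  have "(y has_vector_derivative
      v t + ((\<beta> / t) *\<^sub>R (- (\<alpha> / t) *\<^sub>R v t - h) + - (\<beta> / t\<^sup>2) *\<^sub>R v t)) (at t)"
    unfolding y_def .
  also have "v t + ((\<beta> / t) *\<^sub>R (- (\<alpha> / t) *\<^sub>R v t - h) + - (\<beta> / t\<^sup>2) *\<^sub>R v t) = y'"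
  proof -
    have "1 - c / t\<^sup>2 = 1 + ((\<beta> / t) * - (\<alpha> / t) + - (\<beta> / t\<^sup>2))"
      using t by (simp add: c_def field_simps power2_eq_square)
    then show ?thesis
      unfolding y'_def by (simp only: scaleR_left_distrib scaleR_right_diff_distrib scaleR_scaleR) simp
  qed
  finally have "(y has_derivative (\<lambda>s. s *\<^sub>R y')) (at t)"
    by (simp add: has_vector_derivative_def)
  from has_derivative_compose[OF this g]
  have \<phi>_deriv: "((\<lambda>t. g (y t)) has_real_derivative y' \<bullet> h) (at t)"
    by (simp add: has_field_derivative_def mult_commute_abs)
  define w where "w = (\<lambda>t. \<mu> *\<^sub>R (x t - z) + t *\<^sub>R v t)"
  \<comment> \<open>The factor \<open>t\<close> of \<open>v\<close> cancels the quotient in the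
    damping, which leaves a constant coefficient.\<close>
  define w' where "w' = (\<mu> + 1 - \<alpha>) *\<^sub>R v t - t *\<^sub>R h"
  have X_deriv: "((\<lambda>t. x t - z) has_vector_derivative v t) (at t)"
    using has_vector_derivative_diff[OF x has_vector_derivative_const] by simp
  have "(w has_vector_derivative \<mu> *\<^sub>R v t + (t *\<^sub>R (- (\<alpha> / t) *\<^sub>R v t - h) + 1 *\<^sub>R v t)) (at t)"
    unfolding w_def
    by (intro has_vector_derivative_add has_vector_derivative_scaleR[OF DERIV_ident v]
          bounded_linear.has_vector_derivative[OF bounded_linear_scaleR_right X_deriv])
  also have "\<mu> *\<^sub>R v t + (t *\<^sub>R (- (\<alpha> / t) *\<^sub>R v t - h) + 1 *\<^sub>R v t) = w'"
    using t by (simp add: w'_def scaleR_left_distrib scaleR_left_diff_distrib scaleR_right_diff_distrib)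
  finally have w_deriv: "(w has_vector_derivative w') (at t)" .
  define D where "D = a' * \<phi> + A * (y' \<bullet> h) + w t \<bullet> w' + (\<alpha> - 1 - \<mu>) * \<mu> * ((x t - z) \<bullet> v t)"
  have "((\<lambda>t. energy_weight \<alpha> \<beta> \<mu> t * (g (y t) - g z)) has_real_derivative a' * \<phi> + A * (y' \<bullet> h)) (at t)"
    using DERIV_mult[OF A_deriv DERIV_diff[OF \<phi>_deriv DERIV_const[of "g z"]]]
    by (simp add: A_def \<phi>_def mult.commute)
  from DERIV_add[OF DERIV_add[OF this has_real_derivative_half_norm_square[OF w_deriv]]
      DERIV_cmult[OF has_real_derivative_half_norm_square[OF X_deriv], of "(\<alpha> - 1 - \<mu>) * \<mu>"]]
  have "(energy g \<alpha> \<beta> \<mu> z x v has_real_derivative D) (at t)"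
    unfolding energy_def[abs_def] D_def w_def y_def by simp
  moreover have "(\<mu> - 2) * (t * \<phi>) + \<beta> * (t * (norm h)\<^sup>2) \<le> - D"
  proof -
    define P where "P = (y t - z) \<bullet> h"
    define m r s where "m = v t \<bullet> h" and "r = (x t - z) \<bullet> v t" and "s = v t \<bullet> v t"
    have P: "P \<ge> \<phi>"
      using tangent by (simp add: P_def \<phi>_def inner_diff_left)
    \<comment> \<open>The tangent inequality is based at \<open>y t\<close>, whereas
      \<open>w\<close> contains \<open>x t\<close>; they differ by
      \<open>(\<beta> / t) v t\<close>.\<close>
    have Xh: "t * ((x t - z) \<bullet> h) = t * P - \<beta> * m"
      using t by (simp add: P_def m_def y_def inner_diff_left inner_add_left field_simps)
    have "w t \<bullet> w' = (\<mu> + 1 - \<alpha>) * (\<mu> * r + t * s) - \<mu> * (t * ((x t - z) \<bullet> h)) - t\<^sup>2 * m"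
      by (simp add: w_def w'_def m_def r_def s_def inner_simps algebra_simps power2_eq_square inner_commute)
    also have "\<dots> = (\<mu> + 1 - \<alpha>) * (\<mu> * r + t * s) - \<mu> * (t * P - \<beta> * m) - t\<^sup>2 * m"
      by (simp only: Xh)
    finally have ww: "w t \<bullet> w' = \<dots>" .
    have "A * (y' \<bullet> h) = A * (1 - c / t\<^sup>2) * m - A * (\<beta> / t) * (h \<bullet> h)"
      by (simp add: y'_def m_def inner_diff_left algebra_simps)
    then have "A * (y' \<bullet> h) = (t\<^sup>2 - \<mu> * \<beta>) * m - A * (\<beta> / t) * (h \<bullet> h)"
      by (simp only: A_balance)
    \<comment> \<open>The multiples of \<open>m\<close> cancel by the choice of the weight, those of
      \<open>r\<close> by the factor of the last energy term.\<close>
    then have D: "D = a' * \<phi> - A * (\<beta> / t) * (h \<bullet> h) - (\<alpha> - 1 - \<mu>) * t * s - \<mu> * t * P"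
      unfolding D_def ww r_def[symmetric] by (simp add: algebra_simps)
    have "a' * \<phi> \<le> 2 * t * \<phi>"
      using a' \<open>g z \<le> g (y t)\<close> by (intro mult_right_mono) (auto simp: \<phi>_def)
    moreover have "t\<^sup>2 * (\<beta> / t) * (h \<bullet> h) \<le> A * (\<beta> / t) * (h \<bullet> h)"
      using A_ge t \<beta> by (intro mult_right_mono) auto
    moreover have "t\<^sup>2 * (\<beta> / t) * (h \<bullet> h) = \<beta> * (t * (norm h)\<^sup>2)"
    proof -
      have "t\<^sup>2 * (\<beta> / t) = \<beta> * t"
        using t by (simp add: power2_eq_square)
      then show ?thesis by (simp add: power2_norm_eq_inner)
    qed
    \<comment> \<open>The kinetic term has a favourable sign because
      \<open>\<mu> \<le> \<alpha> - 1\<close>, and it is discarded.\<close>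
    moreover have "0 \<le> (\<alpha> - 1 - \<mu>) * t * s"
      using \<mu> t by (simp add: s_def)
    moreover have "\<mu> * t * \<phi> \<le> \<mu> * t * P"
      using P \<mu> t by (intro mult_left_mono) auto
    ultimately show ?thesis
      unfolding D by (simp add: algebra_simps)
  qed
  ultimately show ?thesis
    unfolding \<phi>_def by blast
qed

section \<open>Decay rate and integrability along the trajectory\<close>

theorem mainTheorem4:
  fixes g :: "real ^ 'm \<Rightarrow> real"
    and x :: "real \<Rightarrow> real ^ 'm"
    and u0 v0 :: "real ^ 'm"
    and Lg t0 \<alpha> \<beta> :: real
  assumes "convex_on UNIV g"
    and "\<forall>z. g differentiable (at z)"
    and "Lg-lipschitz_on UNIV (grad g)"
    and "{z. is_arg_min g (\<lambda>_. True) z} \<noteq> {}"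
    and "t0 > 0" and "\<alpha> > 3" and "\<beta> \<ge> 0"
    and "strong_global_solution g \<alpha> \<beta> t0 u0 v0 x"
  shows "(\<exists>K\<ge>0. \<exists>t1\<ge>t0. \<forall>t\<ge>t1.
            g (x t + (\<beta> / t) *\<^sub>R deriv_from t0 x t) - (INF z. g z) \<le> K / t\<^sup>2) \<and>
         set_integrable lborel {t0..}
           (\<lambda>t. t * (g (x t + (\<beta> / t) *\<^sub>R deriv_from t0 x t) - (INF z. g z))) \<and>
         (\<beta> > 0 \<longrightarrow> set_integrable lborel {t0..}
           (\<lambda>t. t * (norm (grad g (x t + (\<beta> / t) *\<^sub>R deriv_from t0 x t)))\<^sup>2))"
proof -
  obtain z where z: "\<And>w. g z \<le> g w"
    using assms(4) by (auto simp: is_arg_min_linorder)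
  have INF: "(INF z. g z) = g z"
    using z by (intro cInf_eq_minimum) auto
  define v where "v = deriv_from t0 x"
  define y where "y t = x t + (\<beta> / t) *\<^sub>R v t" for t
  \<comment> \<open>The midpoint of 2 and \<open>\<alpha> - 1\<close>, which are in this order
    because \<open>\<alpha> > 3\<close>.\<close>
  define \<mu> where "\<mu> = (\<alpha> + 1) / 2"
  have \<mu>: "\<mu> > 2" "\<mu> \<le> \<alpha> - 1" using \<open>\<alpha> > 3\<close> by (auto simp: \<mu>_def)
  define c where "c = (\<alpha> + 1) * \<beta>"
  have "c \<ge> 0" using \<open>\<alpha> > 3\<close> \<open>\<beta> \<ge> 0\<close> by (simp add: c_def)
  \<comment> \<open>From \<open>t1\<close> on, \<open>t > c\<close> and \<open>t \<ge> 1\<close>, so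
    \<open>t\<^sup>2 \<ge> t > c\<close> and the denominator in the weight is positive.\<close>
  define t1 where "t1 = t0 + c + 1"
  have t1: "t1 > t0" using \<open>c \<ge> 0\<close> by (simp add: t1_def)
  have large: "t > t0" "t > 0" "t\<^sup>2 > (\<alpha> + 1) * \<beta>" if "t \<ge> t1" for t
  proof -
    show "t > t0" "t > 0" using that t1 \<open>t0 > 0\<close> by auto
    have "c < t" "1 \<le> t" using that \<open>t0 > 0\<close> \<open>c \<ge> 0\<close> by (auto simp: t1_def)
    then show "t\<^sup>2 > (\<alpha> + 1) * \<beta>"
      unfolding c_def[symmetric] power2_eq_square
      using mult_left_mono[of 1 t t] by linarith
  qed
  have grad_cont: "continuous_on UNIV (grad g)"
    using assms(3) by (rule lipschitz_on_continuous_on)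
  note regular = strong_global_solution_regular[OF assms(8) \<open>t0 > 0\<close> grad_cont, folded v_def]
  have g_deriv: "(g has_derivative (\<lambda>k. k \<bullet> grad g w)) (at w)" for w
    using GDERIV_grad[OF assms(2)[rule_format, of w]] by (simp add: gderiv_def)
  have g_cont: "continuous_on UNIV g"
    using assms(2) by (auto intro!: continuous_at_imp_continuous_on differentiable_imp_continuous_within)
  have y_cont: "continuous_on {t0..} y"
    unfolding y_def using \<open>t0 > 0\<close> by (intro continuous_intros regular) auto
  have gap_cont: "continuous_on {t0..} (\<lambda>t. t * (g (y t) - g z))"
    by (intro continuous_intros continuous_on_compose2[OF g_cont y_cont]) auto
  have grad_sq_cont: "continuous_on {t0..} (\<lambda>t. t * (norm (grad g (y t)))\<^sup>2)"
    by (intro continuous_intros continuous_on_compose2[OF grad_cont y_cont]) auto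
  have gap_nonneg: "t * (g (y t) - g z) \<ge> 0" and grad_sq_nonneg: "t * (norm (grad g (y t)))\<^sup>2 \<ge> 0"
    if "t \<ge> t0" for t
    using that \<open>t0 > 0\<close> z[of "y t"] by auto
  define E where "E = energy g \<alpha> \<beta> \<mu> z x v"
  have "\<exists>D. (E has_real_derivative D) (at t) \<and>
      (\<mu> - 2) * (t * (g (y t) - g z)) + \<beta> * (t * (norm (grad g (y t)))\<^sup>2) \<le> - D"
    if "t \<ge> t1" for t
    unfolding E_def y_def
    using large[OF that] \<mu> \<open>\<beta> \<ge> 0\<close> z convex_on_gradient_ineq[OF assms(1)] assms(2)
    by (intro energy_deriv regular g_deriv) auto
  then obtain D where E_deriv: "\<And>t. t \<ge> t1 \<Longrightarrow> (E has_real_derivative D t) (at t)"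
    and decay: "\<And>t. t \<ge> t1 \<Longrightarrow>
      (\<mu> - 2) * (t * (g (y t) - g z)) + \<beta> * (t * (norm (grad g (y t)))\<^sup>2) \<le> - D t"
    by metis
  have E_ge: "t\<^sup>2 * (g (y t) - g z) \<le> E t" if "t \<ge> t1" for t
  proof -
    have "t\<^sup>2 * (g (y t) - g z) \<le> energy_weight \<alpha> \<beta> \<mu> t * (g (y t) - g z)"
      using large[OF that] \<mu> \<open>\<beta> \<ge> 0\<close> \<open>\<alpha> > 3\<close> z by (intro mult_right_mono energy_weight_ge) auto
    moreover have "0 \<le> (\<alpha> - 1 - \<mu>) * \<mu> / 2 * (norm (x t - z))\<^sup>2"
      using \<mu> by simp
    moreover have "0 \<le> (norm (\<mu> *\<^sub>R (x t - z) + t *\<^sub>R v t))\<^sup>2 / 2"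
      by simp
    ultimately show ?thesis
      unfolding E_def energy_def y_def by linarith
  qed
  have E_nonneg: "E t \<ge> 0" if "t \<ge> t1" for t
    using E_ge[OF that] z[of "y t"] by (smt (verit) mult_nonneg_nonneg zero_le_power2)
  \<comment> \<open>Both dissipation terms are nonnegative, so each alone is bounded by
    \<open>- D t\<close>; one serves each integral.\<close>
  have gap_decay: "(\<mu> - 2) * (t * (g (y t) - g z)) \<le> - D t"
    and grad_decay: "\<beta> * (t * (norm (grad g (y t)))\<^sup>2) \<le> - D t" if "t \<ge> t1" for t
    using decay[OF that] gap_nonneg[of t] grad_sq_nonneg[of t] that t1 \<mu> \<open>\<beta> \<ge> 0\<close>
    by (smt (verit) mult_nonneg_nonneg)+
  have rate: "g (y t) - g z \<le> E t1 / t\<^sup>2" if "t \<ge> t1" for t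
  proof -
    \<comment> \<open>With integrand 0, \<open>lyapunov_decrease\<close> says that \<open>E\<close>
      does not increase after \<open>t1\<close>.\<close>
    have "integral {t1..t} (\<lambda>_. 0) \<le> E t1 - E t"
    proof (rule lyapunov_decrease[OF E_deriv _ _ that])
      fix s assume "s \<ge> t1"
      then show "0 \<le> - D s"
        using grad_decay[of s] grad_sq_nonneg[of s] t1 \<open>\<beta> \<ge> 0\<close> by (smt (verit) mult_nonneg_nonneg)
    qed auto
    then have "t\<^sup>2 * (g (y t) - g z) \<le> E t1"
      using E_ge[OF that] by simp
    then show ?thesis
      using large[OF that] by (simp add: pos_le_divide_eq mult.commute)
  qed
  have "set_integrable lborel {t0..} (\<lambda>t. t * (g (y t) - g z))"
    by (rule set_integrable_of_lyapunov[where k = "\<mu> - 2", OF gap_cont gap_nonneg _ _ E_deriv gap_decay E_nonneg])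
       (use t1 \<mu> in auto)
  \<comment> \<open>The gradient term carries the factor \<open>\<beta>\<close>, which takes the
    place of \<open>k\<close> and so has to be positive.\<close>
  moreover have "set_integrable lborel {t0..} (\<lambda>t. t * (norm (grad g (y t)))\<^sup>2)" if "\<beta> > 0"
    by (rule set_integrable_of_lyapunov[OF grad_sq_cont grad_sq_nonneg _ that E_deriv grad_decay E_nonneg])
       (use t1 in auto)
  moreover have "\<exists>K\<ge>0. \<exists>t1\<ge>t0. \<forall>t\<ge>t1. g (y t) - g z \<le> K / t\<^sup>2"
    using rate E_nonneg[of t1] t1 by (intro exI[of _ "E t1"] conjI exI[of _ t1]) auto
  ultimately show ?thesis
    unfolding INF by (simp add: y_def v_def)
qed

end
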